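(* Let $S$ be an egalitarian subsampling procedure on a dataset $D$ with $|D|=N$, with associated subsample fraction $r(N)\in(0,1)$, producing subsets $D_1,\dots,D_C$, and let $\rho_0>0$. Then, for $i\ne j$: (i) $\mathbb E[|D_i\cap D_j|]=N r(N)^2$. (ii) $\displaystyle\mathbb P\left(|D_1\cap D_2|\ge Nr(N)\rho_0\right)=\mathbb P\left(|D_1\cap D_2|\ge\frac{\rho_0}{r(N)}\,\mathbb E[|D_i\cap D_j|]\right)$. (iii) (Chernoff bound) With $\delta=\frac{\rho_0}{r(N)}-1$, $$\mathbb P\left(|D_1\cap D_2|\ge Nr(N)\rho_0\right)\le\left(\frac{e^{\delta}}{(1+\delta)^{1+\delta}}\right)^{Nr(N)^2}.$$ (iv) (Hoeffding bound) With $\delta=\frac{\rho_0}{r(N)}-1$, $$\mathbb P\left(|D_1\cap D_2|\ge Nr(N)\rho_0\right)\le e^{-2\delta^2Nr(N)^3}.$$ (v) (Markov bound) $$\mathbb P\left(|D_1\cap D_2|\ge Nr(N)\rho_0\right)\le\frac{r(N)}{\rho_0}.$$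
   Context: A procedure $S$ producing random subsets $D_1,\dots,D_C$ of $D$ is egalitarian with fraction function $r$ if (i) $|D_i|/N=r(N)$, independent of $i$; (ii) each $D_i$ is subsampled uniformly from $D$ (uniform over subsets of size $Nr(N)$); (iii) the $D_i$ are independent. Probabilities and expectations are over the draw of $S$.
   Formalization: Parts (iii) and (iv) are proved only for ρ₀ ≥ r(N), i.e. δ ≥ 0; for ρ₀ < r(N) they can fail: N=4, r(N)=1/2, ρ₀=0.01 gives probability 5/6, while both right-hand sides are below 0.42. *)

theory Defs
  imports "HOL-Probability.Probability"
begin

text \<open>
  The random subset \<open>D\<^sub>i\<close> of the dataset \<open>D\<close> is \<open>S i\<close>, for \<open>i \<in> {1..C}\<close>; it takes values in the
  discrete measurable space \<open>count_space (Pow D)\<close>, its measurability being part of \<open>indep_vars\<close>.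
  All draws live on one probability space \<open>M\<close>, the randomness of the procedure.
\<close>

locale egalitarian_subsampling = prob_space M
  for M :: "'w measure" and D :: "'a set" and C :: nat
    and S :: "nat \<Rightarrow> 'w \<Rightarrow> 'a set" and r :: "nat \<Rightarrow> real" +
  assumes finite_dataset: "finite D"
    and equal_fraction:
      "\<And>i \<omega>. i \<in> {1..C} \<Longrightarrow> \<omega> \<in> space M \<Longrightarrow>
        real (card (S i \<omega>)) / real (card D) = r (card D)"
    and uniform_subsample:
      "\<And>i. i \<in> {1..C} \<Longrightarrow>
        distr M (count_space (Pow D)) (S i) =
        uniform_measure (count_space (Pow D))
          {A. A \<subseteq> D \<and> real (card A) = real (card D) * r (card D)}"
    and independent_subsamples:
      "indep_vars (\<lambda>_. count_space (Pow D)) S {1..C}"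

end

theory Submission
  imports Defs
begin

text \<open>
  Conditionally on \<open>D\<^sub>2\<close>, the overlap of two subsamples is hypergeometric. Double counting gives its
  mean. Its generating function at \<open>1 + y\<close>, \<open>y \<ge> 0\<close>, is the sum of \<open>y\<close> to the power \<open>|T|\<close> times the
  probability that \<open>T \<subseteq> D\<^sub>1\<close>, over \<open>T \<subseteq> D\<^sub>2\<close>; since this probability is at most \<open>r\<close> to the power \<open>|T|\<close>,
  it is dominated by the generating function of a binomial distribution, and the exponential Markov
  inequality yields the Chernoff and Hoeffding bounds as for independent trials.
\<close>

section \<open>Counting the \<open>k\<close>-subsets of a finite set by their overlap with a fixed
  subset\<close>

lemma sum_power_card_Pow:
  fixes y :: "'b::comm_semiring_1"
  assumes "finite X"
  shows "(\<Sum>T\<in>Pow X. y ^ card T) = (1 + y) ^ card X"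
  using assms
proof (induction X rule: finite_induct)
  case (insert x X)
  have "(\<Sum>T\<in>Pow (insert x X). y ^ card T)
      = (\<Sum>T\<in>Pow X. y ^ card T) + (\<Sum>T\<in>insert x ` Pow X. y ^ card T)"
    unfolding Pow_insert using insert.hyps by (intro sum.union_disjoint) auto
  also have "(\<Sum>T\<in>insert x ` Pow X. y ^ card T) = (\<Sum>T\<in>Pow X. y ^ card (insert x T))"
    using insert.hyps by (subst sum.reindex) (auto simp: inj_on_def)
  also have "\<dots> = (\<Sum>T\<in>Pow X. y * y ^ card T)"
  proof (intro sum.cong refl)
    fix T assume "T \<in> Pow X"
    then have "finite T" "x \<notin> T"
      using insert.hyps finite_subset by auto
    then show "y ^ card (insert x T) = y * y ^ card T" by simp
  qed
  also have "(\<Sum>T\<in>Pow X. y ^ card T) + \<dots> = (1 + y) * (\<Sum>T\<in>Pow X. y ^ card T)"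
    by (simp only: sum_distrib_left [symmetric] distrib_right mult_1_left)
  finally show ?case
    using insert by simp
qed simp

text \<open>Removing \<open>T\<close> maps these sets bijectively onto the subsets of
  \<open>D - T\<close> of size \<open>k - card T\<close>. The bound \<open>card T \<le> k\<close>
  matters: otherwise the truncated difference is 0 and the right-hand side is 1, although no such
  set exists.\<close>

lemma card_subsets_containing:
  assumes "finite D" "T \<subseteq> D" "card T \<le> k"
  shows "card {A. A \<subseteq> D \<and> card A = k \<and> T \<subseteq> A} = (card D - card T) choose (k - card T)"
proof -
  have fin: "finite A" if "A \<subseteq> D" for A
    using that assms(1) finite_subset by blast
  have "bij_betw (\<lambda>A. A - T) {A. A \<subseteq> D \<and> card A = k \<and> T \<subseteq> A}
          {B. B \<subseteq> D - T \<and> card B = k - card T}"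
  proof (rule bij_betwI[where g = "\<lambda>B. B \<union> T"])
    show "(\<lambda>A. A - T) \<in> {A. A \<subseteq> D \<and> card A = k \<and> T \<subseteq> A} \<rightarrow> {B. B \<subseteq> D - T \<and> card B = k - card T}"
      using fin[OF assms(2)] by (auto simp: card_Diff_subset)
    have "card (B \<union> T) = k" if "B \<subseteq> D - T" "card B = k - card T" for B
    proof -
      have "B \<subseteq> D" "B \<inter> T = {}"
        using that(1) by auto
      then show ?thesis
        using that(2) assms(3) by (subst card_Un_disjoint) (simp_all add: fin assms(2))
    qed
    then show "(\<lambda>B. B \<union> T) \<in> {B. B \<subseteq> D - T \<and> card B = k - card T} \<rightarrow> {A. A \<subseteq> D \<and> card A = k \<and> T \<subseteq> A}"
      using assms(2) by auto
  qed auto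
  then have "card {A. A \<subseteq> D \<and> card A = k \<and> T \<subseteq> A} = card {B. B \<subseteq> D - T \<and> card B = k - card T}"
    by (rule bij_betw_same_card)
  also have "\<dots> = card (D - T) choose (k - card T)"
    using assms(1) by (intro n_subsets) auto
  finally show ?thesis
    using assms(2) fin by (simp add: card_Diff_subset)
qed

text \<open>The ratio of the two coefficients is the product of \<open>(k - s) / (n - s)\<close>
  over \<open>s < t\<close>, and each factor is at most \<open>k / n\<close>. The induction peels
  off one factor at a time.\<close>

lemma binomial_diff_diff_le:
  assumes "t \<le> k" "k \<le> n" "0 < n"
  shows "real ((n - t) choose (k - t)) \<le> (real k / real n) ^ t * real (n choose k)"
  using assms(1)
proof (induction t)
  case (Suc t)
  define m where "m = n - Suc t"
  define l where "l = k - Suc t"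
  have nt: "n - t = Suc m" and kt: "k - t = Suc l" and nk: "n = m + Suc t" "k = l + Suc t"
    using Suc.prems assms by (auto simp: m_def l_def)
  have "l \<le> m" using nk assms by simp
  have "Suc l * (Suc m choose Suc l) = Suc m * (m choose l)"
    using Suc_times_binomial_eq[of m l] by (simp only: mult.commute)
  then have "real (Suc l) * real (Suc m choose Suc l) = real (Suc m) * real (m choose l)"
    by (metis of_nat_mult)
  then have "real (m choose l) = real (Suc l) / real (Suc m) * real (Suc m choose Suc l)"
    by (simp add: field_simps)
  also have "\<dots> \<le> real k / real n * real (Suc m choose Suc l)"
  proof (intro mult_right_mono)
    \<comment> \<open>Expanding (l+1)(m+1+t) and (l+1+t)(m+1) and cancelling the common terms leaves
      exactly this inequality.\<close>
    have "l * t \<le> m * t" using \<open>l \<le> m\<close> by simp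
    then have "Suc l * n \<le> k * Suc m"
      unfolding nk using \<open>l \<le> m\<close> by (simp add: algebra_simps)
    then have "real (Suc l) * real n \<le> real k * real (Suc m)"
      by (metis of_nat_mono of_nat_mult)
    then show "real (Suc l) / real (Suc m) \<le> real k / real n"
      using assms by (simp add: field_simps)
  qed auto
  also have "\<dots> \<le> real k / real n * ((real k / real n) ^ t * real (n choose k))"
    using Suc nt kt by (intro mult_left_mono) auto
  finally show ?case
    by (simp add: m_def l_def mult.assoc)
qed simp

text \<open>Comparison with independent trials: a uniform \<open>k\<close>-subset contains
  \<open>T\<close> with probability at most the one obtained by including each element independently
  with probability \<open>k / card D\<close>.\<close>

lemma card_subsets_containing_le:
  assumes "finite D" "D \<noteq> {}" "T \<subseteq> D" "k \<le> card D"
  shows "real (card {A. A \<subseteq> D \<and> card A = k \<and> T \<subseteq> A})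
       \<le> (real k / real (card D)) ^ card T * real (card D choose k)"
proof (cases "card T \<le> k")
  case True
  then show ?thesis
    using binomial_diff_diff_le[of "card T" k "card D"] assms
    by (simp add: card_subsets_containing card_gt_0_iff)
next
  case False
  then have "{A. A \<subseteq> D \<and> card A = k \<and> T \<subseteq> A} = {}"
    using assms(1) by (auto dest: card_mono[OF finite_subset])
  then show ?thesis by (simp del: Collect_empty_eq)
qed

text \<open>Double counting of the pairs of a \<open>k\<close>-subset \<open>A\<close> and a point
  of \<open>A \<inter> B\<close>: each point of \<open>B\<close> lies in
  \<open>(card D - 1) choose (k - 1)\<close> of the \<open>k\<close>-subsets.\<close>

lemma sum_card_Int_subsets:
  assumes "finite D" "B \<subseteq> D" "0 < k"
  shows "real (\<Sum>A | A \<subseteq> D \<and> card A = k. card (A \<inter> B))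
       = real (card B) * (real k / real (card D)) * real (card D choose k)"
proof (cases "D = {}")
  case False
  then have "card D > 0"
    using assms(1) by (simp add: card_gt_0_iff)
  have fin: "finite {A. A \<subseteq> D \<and> card A = k}" "finite B"
    using assms finite_subset by auto
  have "(\<Sum>A | A \<subseteq> D \<and> card A = k. card (A \<inter> B))
      = (\<Sum>A | A \<subseteq> D \<and> card A = k. \<Sum>x | x \<in> B \<and> x \<in> A. 1)"
    by (simp add: Int_def conj_commute)
  also have "\<dots> = (\<Sum>x\<in>B. \<Sum>A | A \<in> {A. A \<subseteq> D \<and> card A = k} \<and> x \<in> A. 1)"
    by (rule sum.swap_restrict) (use fin in auto)
  also have "\<dots> = (\<Sum>x\<in>B. (card D - 1) choose (k - 1))"
  proof (intro sum.cong refl)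
    fix x assume "x \<in> B"
    then show "(\<Sum>A | A \<in> {A. A \<subseteq> D \<and> card A = k} \<and> x \<in> A. 1) = (card D - 1) choose (k - 1)"
      using card_subsets_containing[of D "{x}" k] assms by (auto simp: conj_assoc)
  qed
  finally have eq: "(\<Sum>A | A \<subseteq> D \<and> card A = k. card (A \<inter> B)) = card B * ((card D - 1) choose (k - 1))"
    by simp
  have "k * (card D choose k) = card D * ((card D - 1) choose (k - 1))"
    using times_binomial_minus1_eq[of k "card D"] assms by simp
  then have "real k * real (card D choose k) = real (card D) * real ((card D - 1) choose (k - 1))"
    by (metis of_nat_mult)
  with eq \<open>card D > 0\<close> show ?thesis
    by (simp add: field_simps)
qed (use assms in auto)

text \<open>Each power is expanded over the subsets \<open>T\<close> of \<open>A \<inter> B\<close>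
  and the sums are swapped. Since \<open>y \<ge> 0\<close>, the count of \<open>A\<close> containing
  \<open>T\<close> can be bounded term by term, and the sum over \<open>T\<close> is then folded
  back.\<close>

lemma sum_power_card_Int_subsets_le:
  fixes y :: real
  assumes "finite D" "D \<noteq> {}" "B \<subseteq> D" "k \<le> card D" "0 \<le> y"
  shows "(\<Sum>A | A \<subseteq> D \<and> card A = k. (1 + y) ^ card (A \<inter> B))
       \<le> (1 + real k / real (card D) * y) ^ card B * real (card D choose k)"
proof -
  have fin: "finite {A. A \<subseteq> D \<and> card A = k}" "finite (Pow B)" "finite B"
    using assms finite_subset by auto
  have "(\<Sum>A | A \<subseteq> D \<and> card A = k. (1 + y) ^ card (A \<inter> B))
      = (\<Sum>A | A \<subseteq> D \<and> card A = k. \<Sum>T | T \<in> Pow B \<and> T \<subseteq> A. y ^ card T)"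
    using fin by (intro sum.cong refl, subst sum_power_card_Pow [symmetric])
      (auto intro!: sum.cong)
  also have "\<dots> = (\<Sum>T\<in>Pow B. \<Sum>A | A \<in> {A. A \<subseteq> D \<and> card A = k} \<and> T \<subseteq> A. y ^ card T)"
    by (rule sum.swap_restrict) (use fin in auto)
  also have "\<dots> = (\<Sum>T\<in>Pow B. y ^ card T * real (card {A. A \<subseteq> D \<and> card A = k \<and> T \<subseteq> A}))"
    by (simp add: conj_assoc mult.commute)
  also have "\<dots> \<le> (\<Sum>T\<in>Pow B. y ^ card T * ((real k / real (card D)) ^ card T * real (card D choose k)))"
    using assms by (intro sum_mono mult_left_mono card_subsets_containing_le) auto
  also have "\<dots> = (\<Sum>T\<in>Pow B. (real k / real (card D) * y) ^ card T) * real (card D choose k)"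
    unfolding sum_distrib_right power_mult_distrib by (simp only: mult_ac)
  also have "\<dots> = (1 + real k / real (card D) * y) ^ card B * real (card D choose k)"
    using fin by (simp add: sum_power_card_Pow)
  finally show ?thesis .
qed

section \<open>Expectations of functions of two finitely valued random variables\<close>

lemma (in prob_space) expectation_finite_pair:
  fixes g :: "'b \<Rightarrow> 'c \<Rightarrow> real"
  assumes "random_variable (count_space K) X" "random_variable (count_space L) Y"
    and "finite F" "finite G" "F \<subseteq> K" "G \<subseteq> L"
    and range: "\<And>\<omega>. \<omega> \<in> space M \<Longrightarrow> X \<omega> \<in> F \<and> Y \<omega> \<in> G"
  shows "expectation (\<lambda>\<omega>. g (X \<omega>) (Y \<omega>))
       = (\<Sum>B\<in>G. \<Sum>A\<in>F. g A B * \<P>(\<omega> in M. X \<omega> = A \<and> Y \<omega> = B))"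
    and "integrable M (\<lambda>\<omega>. g (X \<omega>) (Y \<omega>))"
proof -
  define E where "E A B = {\<omega> \<in> space M. X \<omega> = A \<and> Y \<omega> = B}" for A B
  have sets: "E A B \<in> sets M" if "A \<in> F" "B \<in> G" for A B
  proof -
    have "E A B = (X -` {A} \<inter> space M) \<inter> (Y -` {B} \<inter> space M)"
      by (auto simp: E_def)
    then show ?thesis
      using that assms(5,6) measurable_sets[OF assms(1), of "{A}"] measurable_sets[OF assms(2), of "{B}"]
      by auto
  qed
  \<comment> \<open>At each point of the space exactly one of the events \<open>E A B\<close>
    occurs, so the function is a finite combination of indicators.\<close>
  have eq: "g (X \<omega>) (Y \<omega>) = (\<Sum>B\<in>G. \<Sum>A\<in>F. g A B * indicator (E A B) \<omega>)" if "\<omega> \<in> space M" for \<omega>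
  proof -
    have "(\<Sum>B\<in>G. \<Sum>A\<in>F. g A B * indicator (E A B) \<omega>)
        = (\<Sum>B\<in>G. \<Sum>A\<in>F. if A = X \<omega> then if B = Y \<omega> then g A B else 0 else 0)"
      using that by (intro sum.cong refl) (auto simp: E_def indicator_def)
    also have "\<dots> = g (X \<omega>) (Y \<omega>)"
      using range[OF that] assms(3,4) by simp
    finally show ?thesis by simp
  qed
  have int: "integrable M (\<lambda>\<omega>. g A B * indicator (E A B) \<omega>)" if "A \<in> F" "B \<in> G" for A B
    using sets[OF that] by (intro integrable_mult_right integrable_real_indicator)
      (auto simp: emeasure_eq_measure)
  show "integrable M (\<lambda>\<omega>. g (X \<omega>) (Y \<omega>))"
    by (subst Bochner_Integration.integrable_cong[OF refl eq])
      (auto intro!: Bochner_Integration.integrable_sum int)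
  have "expectation (\<lambda>\<omega>. g (X \<omega>) (Y \<omega>))
      = expectation (\<lambda>\<omega>. \<Sum>B\<in>G. \<Sum>A\<in>F. g A B * indicator (E A B) \<omega>)"
    by (intro Bochner_Integration.integral_cong refl eq)
  also have "\<dots> = (\<Sum>B\<in>G. \<Sum>A\<in>F. expectation (\<lambda>\<omega>. g A B * indicator (E A B) \<omega>))"
    using int by (simp add: Bochner_Integration.integral_sum)
  also have "\<dots> = (\<Sum>B\<in>G. \<Sum>A\<in>F. g A B * \<P>(\<omega> in M. X \<omega> = A \<and> Y \<omega> = B))"
    using sets by (intro sum.cong refl) (simp add: E_def)
  finally show "expectation (\<lambda>\<omega>. g (X \<omega>) (Y \<omega>))
       = (\<Sum>B\<in>G. \<Sum>A\<in>F. g A B * \<P>(\<omega> in M. X \<omega> = A \<and> Y \<omega> = B))" .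
qed

section \<open>The joint law of two subsamples\<close>

context egalitarian_subsampling
begin

text \<open>The size condition is kept in real form to agree literally with
  \<open>uniform_subsample\<close>; \<open>subsample_size\<close> turns it into
  \<open>card A = k\<close> for a natural number \<open>k\<close>.\<close>

definition subsamples :: "'a set set" where
  "subsamples = {A. A \<subseteq> D \<and> real (card A) = real (card D) * r (card D)}"

lemma finite_subsamples: "finite subsamples"
  using finite_dataset by (simp add: subsamples_def)

lemma measurable_subsample:
  assumes "i \<in> {1..C}"
  shows "random_variable (count_space (Pow D)) (S i)"
  using independent_subsamples assms unfolding indep_vars_def by blast

lemma subsample_in_subsamples:
  assumes "i \<in> {1..C}" "\<omega> \<in> space M" "r (card D) > 0"
  shows "S i \<omega> \<in> subsamples"
proof -
  have "S i \<omega> \<subseteq> D"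
    using measurable_space[OF measurable_subsample[OF assms(1)] assms(2)] by simp
  moreover have "real (card (S i \<omega>)) = real (card D) * r (card D)"
    \<comment> \<open>If \<open>card D = 0\<close>, the quotient in \<open>equal_fraction\<close> is
      0 by the convention for division by zero, against \<open>r (card D) > 0\<close>.\<close>
    using equal_fraction[OF assms(1,2)] assms(3) by (cases "card D = 0") (auto simp: field_simps)
  ultimately show ?thesis
    by (simp add: subsamples_def)
qed

lemma prob_subsample_eq:
  assumes "i \<in> {1..C}" "A \<in> subsamples"
  shows "\<P>(\<omega> in M. S i \<omega> = A) = 1 / real (card subsamples)"
proof -
  have sub: "subsamples \<subseteq> Pow D" and "A \<subseteq> D"
    using assms(2) by (auto simp: subsamples_def)
  \<comment> \<open>Together with \<open>pos\<close> this shows that the normalising mass is finite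
    and nonzero, as \<open>measure_uniform_measure\<close> requires.\<close>
  have em: "emeasure (count_space (Pow D)) subsamples = ennreal (real (card subsamples))"
    using sub finite_subsamples by (simp add: emeasure_count_space_finite ennreal_of_nat_eq_real_of_nat)
  have pos: "card subsamples > 0"
    using assms(2) finite_subsamples by (auto simp: card_gt_0_iff)
  have "\<P>(\<omega> in M. S i \<omega> = A) = measure (distr M (count_space (Pow D)) (S i)) {A}"
    using \<open>A \<subseteq> D\<close> measurable_subsample[OF assms(1)]
    by (subst measure_distr) (auto intro!: arg_cong[where f = "measure M"])
  also have "\<dots> = measure (uniform_measure (count_space (Pow D)) subsamples) {A}"
    using uniform_subsample[OF assms(1)] by (simp add: subsamples_def)
  also have "\<dots> = measure (count_space (Pow D)) (subsamples \<inter> {A}) / measure (count_space (Pow D)) subsamples"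
    using em pos \<open>A \<subseteq> D\<close> by (intro measure_uniform_measure) auto
  also have "\<dots> = 1 / real (card subsamples)"
    using sub finite_subsamples assms(2) \<open>A \<subseteq> D\<close> by (simp add: measure_count_space)
  finally show ?thesis .
qed

lemma prob_subsample_pair_eq:
  assumes "i \<in> {1..C}" "j \<in> {1..C}" "i \<noteq> j" "A \<in> subsamples" "B \<in> subsamples"
  shows "\<P>(\<omega> in M. S i \<omega> = A \<and> S j \<omega> = B) = 1 / (real (card subsamples))\<^sup>2"
proof -
  have sub: "A \<subseteq> D" "B \<subseteq> D"
    using assms(4,5) by (auto simp: subsamples_def)
  define X where "X l = (if l = i then {A} else {B})" for l
  have "\<P>(\<omega> in M. S i \<omega> = A \<and> S j \<omega> = B) = prob (\<Inter>l\<in>{i, j}. S l -` X l \<inter> space M)"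
    using assms(3) by (intro arg_cong[where f = prob]) (auto simp: X_def)
  also have "\<dots> = (\<Prod>l\<in>{i, j}. prob (S l -` X l \<inter> space M))"
    using assms sub by (intro indep_varsD[OF independent_subsamples]) (auto simp: X_def)
  also have "\<dots> = \<P>(\<omega> in M. S i \<omega> = A) * \<P>(\<omega> in M. S j \<omega> = B)"
    using assms(3) by (simp add: X_def vimage_def Int_def conj_commute)
  finally show ?thesis
    using prob_subsample_eq assms by (simp add: power2_eq_square)
qed

text \<open>By independence the pair is uniform on \<open>subsamples \<times> subsamples\<close>, so
  expectations are plain averages and the rest is counting.\<close>

lemma expectation_subsample_pair:
  fixes g :: "'a set \<Rightarrow> 'a set \<Rightarrow> real"
  assumes "i \<in> {1..C}" "j \<in> {1..C}" "i \<noteq> j" "r (card D) > 0"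
  shows "expectation (\<lambda>\<omega>. g (S i \<omega>) (S j \<omega>))
       = (\<Sum>B\<in>subsamples. \<Sum>A\<in>subsamples. g A B) / (real (card subsamples))\<^sup>2"
    and "integrable M (\<lambda>\<omega>. g (S i \<omega>) (S j \<omega>))"
proof -
  have sub: "subsamples \<subseteq> Pow D"
    by (auto simp: subsamples_def)
  note * = expectation_finite_pair[OF measurable_subsample[OF assms(1)] measurable_subsample[OF assms(2)]
      finite_subsamples finite_subsamples sub sub, of g]
  have "expectation (\<lambda>\<omega>. g (S i \<omega>) (S j \<omega>))
      = (\<Sum>B\<in>subsamples. \<Sum>A\<in>subsamples. g A B * \<P>(\<omega> in M. S i \<omega> = A \<and> S j \<omega> = B))"
    using subsample_in_subsamples assms by (intro *) auto
  also have "\<dots> = (\<Sum>B\<in>subsamples. \<Sum>A\<in>subsamples. g A B * (1 / (real (card subsamples))\<^sup>2))"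
    using assms by (intro sum.cong refl) (simp add: prob_subsample_pair_eq)
  finally show "expectation (\<lambda>\<omega>. g (S i \<omega>) (S j \<omega>))
       = (\<Sum>B\<in>subsamples. \<Sum>A\<in>subsamples. g A B) / (real (card subsamples))\<^sup>2"
    by (simp add: sum_divide_distrib)
  show "integrable M (\<lambda>\<omega>. g (S i \<omega>) (S j \<omega>))"
    using subsample_in_subsamples assms by (intro *) auto
qed

text \<open>The space of a probability measure is nonempty, so some subsample is realised; its
  cardinality is the required \<open>k\<close>.\<close>

lemma subsample_size:
  assumes "i \<in> {1..C}" "r (card D) > 0"
  obtains k where "subsamples = {A. A \<subseteq> D \<and> card A = k}" "card subsamples = card D choose k"
    and "0 < k" "k \<le> card D" "r (card D) = real k / real (card D)"
proof -
  obtain \<omega> where \<omega>: "\<omega> \<in> space M"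
    using not_empty by blast
  define k where "k = card (S i \<omega>)"
  have S: "S i \<omega> \<subseteq> D" "real k = real (card D) * r (card D)"
    using subsample_in_subsamples[OF assms(1) \<omega> assms(2)] by (auto simp: subsamples_def k_def)
  have "real k / real (card D) = r (card D)"
    using equal_fraction[OF assms(1) \<omega>] by (simp add: k_def)
  moreover from this have "0 < k"
    using assms(2) by (cases k) auto
  moreover have "subsamples = {A. A \<subseteq> D \<and> card A = k}"
    using S(2) by (auto simp: subsamples_def)
  moreover have "k \<le> card D"
    using S(1) finite_dataset by (simp add: k_def card_mono)
  ultimately show ?thesis
    using finite_dataset by (intro that[of k]) (auto simp: n_subsets)
qed

section \<open>Mean and generating function of the overlap\<close>

text \<open>For fixed \<open>B\<close> the average over \<open>A\<close> is
  \<open>real k * r (card D)\<close>, the same for every \<open>B\<close>, hence also the overall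
  mean.\<close>

lemma expectation_card_Int:
  assumes "i \<in> {1..C}" "j \<in> {1..C}" "i \<noteq> j" "r (card D) > 0"
  shows "expectation (\<lambda>\<omega>. real (card (S i \<omega> \<inter> S j \<omega>))) = real (card D) * (r (card D))\<^sup>2"
proof -
  obtain k where k: "subsamples = {A. A \<subseteq> D \<and> card A = k}" "card subsamples = card D choose k"
      "0 < k" "k \<le> card D" "r (card D) = real k / real (card D)"
    using subsample_size[OF assms(1,4)] .
  define b where "b = real (card D choose k)"
  have "b > 0"
    using k(4) by (simp add: b_def)
  have "(\<Sum>B\<in>subsamples. \<Sum>A\<in>subsamples. real (card (A \<inter> B)))
      = (\<Sum>B\<in>subsamples. real k * r (card D) * b)"
  proof (intro sum.cong refl)
    fix B assume "B \<in> subsamples"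
    then show "(\<Sum>A\<in>subsamples. real (card (A \<inter> B))) = real k * r (card D) * b"
      using sum_card_Int_subsets[OF finite_dataset, of B k] k by (simp add: b_def)
  qed
  also have "\<dots> = b * (real k * r (card D) * b)"
    using k(2) by (simp add: b_def)
  finally have "expectation (\<lambda>\<omega>. real (card (S i \<omega> \<inter> S j \<omega>))) = real k * r (card D)"
    using \<open>b > 0\<close> k(2) expectation_subsample_pair(1)[OF assms, of "\<lambda>A B. real (card (A \<inter> B))"]
    by (simp add: power2_eq_square b_def)
  then show ?thesis
    using k(3,4,5) by (simp add: power2_eq_square)
qed

text \<open>The bound is the generating function at \<open>1 + y\<close> of a binomial variable with
  \<open>card D * r (card D)\<close> trials and success probability
  \<open>r (card D)\<close>.\<close>

lemma expectation_power_card_Int_le: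
  assumes "i \<in> {1..C}" "j \<in> {1..C}" "i \<noteq> j" "r (card D) > 0" "0 \<le> y"
  shows "expectation (\<lambda>\<omega>. (1 + y) ^ card (S i \<omega> \<inter> S j \<omega>))
       \<le> (1 + r (card D) * y) powr (real (card D) * r (card D))"
proof -
  obtain k where k: "subsamples = {A. A \<subseteq> D \<and> card A = k}" "card subsamples = card D choose k"
      "0 < k" "k \<le> card D" "r (card D) = real k / real (card D)"
    using subsample_size[OF assms(1,4)] .
  define b where "b = real (card D choose k)"
  have "b > 0"
    using k(4) by (simp add: b_def)
  have "(\<Sum>B\<in>subsamples. \<Sum>A\<in>subsamples. (1 + y) ^ card (A \<inter> B))
      \<le> (\<Sum>B\<in>subsamples. (1 + r (card D) * y) ^ k * b)"
  proof (intro sum_mono)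
    fix B assume "B \<in> subsamples"
    then show "(\<Sum>A\<in>subsamples. (1 + y) ^ card (A \<inter> B)) \<le> (1 + r (card D) * y) ^ k * b"
      using sum_power_card_Int_subsets_le[OF finite_dataset, of B k y] k assms(5)
      by (cases "D = {}") (auto simp: b_def)
  qed
  also have "\<dots> = (1 + r (card D) * y) ^ k * b\<^sup>2"
    using k(2) by (simp add: b_def power2_eq_square)
  finally have "expectation (\<lambda>\<omega>. (1 + y) ^ card (S i \<omega> \<inter> S j \<omega>)) \<le> (1 + r (card D) * y) ^ k"
    using \<open>b > 0\<close> k(2) expectation_subsample_pair(1)[OF assms(1-4), of "\<lambda>A B. (1 + y) ^ card (A \<inter> B)"]
    by (simp add: b_def divide_le_eq)
  also have "\<dots> = (1 + r (card D) * y) powr real k"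
    using assms(4,5) by (intro powr_realpow [symmetric] add_pos_nonneg) auto
  also have "real k = real (card D) * r (card D)"
    using k(3,4,5) by simp
  finally show ?thesis .
qed

section \<open>Exponential tail bounds\<close>

lemma prob_card_Int_ge_le:
  assumes "i \<in> {1..C}" "j \<in> {1..C}" "i \<noteq> j" "r (card D) > 0" "0 \<le> l"
  shows "\<P>(\<omega> in M. real (card (S i \<omega> \<inter> S j \<omega>)) \<ge> a)
       \<le> (1 + r (card D) * (exp l - 1)) powr (real (card D) * r (card D)) * exp (- l * a)"
proof -
  have power: "exp (l * real n) = (1 + (exp l - 1)) ^ n" for n
    by (simp add: exp_of_nat2_mult)
  have int: "integrable M (\<lambda>\<omega>. exp (l * real (card (S i \<omega> \<inter> S j \<omega>))))"
    by (rule expectation_subsample_pair(2)[OF assms(1-4)])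
  have meas: "{\<omega> \<in> space M. exp (l * real (card (S i \<omega> \<inter> S j \<omega>))) \<ge> exp (l * a)} \<in> sets M"
    using borel_measurable_integrable[OF int] by measurable
  \<comment> \<open>Only an inclusion of events is claimed, because for \<open>l = 0\<close> the
    second event is the whole space.\<close>
  have "\<P>(\<omega> in M. real (card (S i \<omega> \<inter> S j \<omega>)) \<ge> a)
      \<le> \<P>(\<omega> in M. exp (l * real (card (S i \<omega> \<inter> S j \<omega>))) \<ge> exp (l * a))"
    using meas assms(5) by (intro finite_measure_mono) (auto intro: mult_left_mono)
  also have "\<dots> \<le> expectation (\<lambda>\<omega>. exp (l * real (card (S i \<omega> \<inter> S j \<omega>)))) / exp (l * a)"
    using int by (intro integral_Markov_inequality_measure[where A = "{}"]) auto
  also have "\<dots> = expectation (\<lambda>\<omega>. exp (l * real (card (S i \<omega> \<inter> S j \<omega>)))) * exp (- l * a)"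
    by (simp add: exp_minus divide_inverse)
  also have "\<dots> \<le> (1 + r (card D) * (exp l - 1)) powr (real (card D) * r (card D)) * exp (- l * a)"
    unfolding power using assms by (intro mult_right_mono expectation_power_card_Int_le) auto
  finally show ?thesis .
qed

text \<open>The exponential Markov bound is taken at \<open>l = ln (1 + \<delta>)\<close>, where
  \<open>exp l - 1 = \<delta>\<close>; then
  \<open>1 + q * \<delta> \<le> exp (q * \<delta>)\<close>. This \<open>l\<close> minimises the
  bound obtained after the exponential estimate.\<close>

lemma prob_card_Int_Chernoff:
  assumes "i \<in> {1..C}" "j \<in> {1..C}" "i \<noteq> j" "r (card D) > 0" "0 \<le> \<delta>"
  shows "\<P>(\<omega> in M. real (card (S i \<omega> \<inter> S j \<omega>)) \<ge> (1 + \<delta>) * (real (card D) * (r (card D))\<^sup>2))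
       \<le> (exp \<delta> / (1 + \<delta>) powr (1 + \<delta>)) powr (real (card D) * (r (card D))\<^sup>2)"
proof -
  define q where "q = r (card D)"
  define \<mu> where "\<mu> = real (card D) * q\<^sup>2"
  have "q > 0" using assms(4) by (simp add: q_def)
  have "\<P>(\<omega> in M. real (card (S i \<omega> \<inter> S j \<omega>)) \<ge> (1 + \<delta>) * \<mu>)
      \<le> (1 + q * (exp (ln (1 + \<delta>)) - 1)) powr (real (card D) * q) * exp (- ln (1 + \<delta>) * ((1 + \<delta>) * \<mu>))"
    unfolding q_def using assms by (intro prob_card_Int_ge_le) auto
  also have "\<dots> \<le> exp (q * \<delta>) powr (real (card D) * q) * exp (- ln (1 + \<delta>) * ((1 + \<delta>) * \<mu>))"
    using assms(5) \<open>q > 0\<close> by (intro mult_right_mono powr_mono2) (auto intro: exp_ge_add_one_self)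
  also have "\<dots> = (exp \<delta> / (1 + \<delta>) powr (1 + \<delta>)) powr \<mu>"
    using assms(5) by (simp add: powr_def ln_div \<mu>_def power2_eq_square algebra_simps flip: exp_add)
  finally show ?thesis
    by (simp add: \<mu>_def q_def)
qed

lemma prob_card_Int_Hoeffding:
  assumes "i \<in> {1..C}" "j \<in> {1..C}" "i \<noteq> j" "r (card D) > 0" "0 \<le> \<delta>"
  shows "\<P>(\<omega> in M. real (card (S i \<omega> \<inter> S j \<omega>)) \<ge> (1 + \<delta>) * (real (card D) * (r (card D))\<^sup>2))
       \<le> exp (- 2 * \<delta>\<^sup>2 * real (card D) * r (card D) ^ 3)"
proof -
  define q where "q = r (card D)"
  define n where "n = real (card D)"
  have "q > 0" using assms(4) by (simp add: q_def)
  \<comment> \<open>the minimiser of the exponent \<open>l\<^sup>2 / 8 - l * q * \<delta>\<close> obtained from Hoeffding's lemma\<close>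
  define l where "l = 4 * q * \<delta>"
  have "l \<ge> 0" using \<open>q > 0\<close> assms(5) by (simp add: l_def)
  have pos: "1 + q * (exp l - 1) > 0"
    using \<open>q > 0\<close> \<open>l \<ge> 0\<close> by (intro add_pos_nonneg) auto
  have "\<P>(\<omega> in M. real (card (S i \<omega> \<inter> S j \<omega>)) \<ge> (1 + \<delta>) * (n * q\<^sup>2))
      \<le> (1 + q * (exp l - 1)) powr (n * q) * exp (- l * ((1 + \<delta>) * (n * q\<^sup>2)))"
    unfolding q_def n_def using assms \<open>l \<ge> 0\<close> by (intro prob_card_Int_ge_le) auto
  also have "\<dots> = exp (n * q * (ln (1 + q * (exp l - 1)) - l * q - l * q * \<delta>))"
    using pos by (simp add: powr_def power2_eq_square algebra_simps flip: exp_add)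
  \<comment> \<open>The difference of the first two terms is the logarithmic moment generating
    function of a centred Bernoulli variable with parameter \<open>q\<close>, at most
    \<open>l\<^sup>2 / 8\<close> by Hoeffding's lemma.\<close>
  also have "\<dots> \<le> exp (n * q * (l\<^sup>2 / 8 - l * q * \<delta>))"
    using Hoeffdings_lemma_aux[of l q] \<open>l \<ge> 0\<close> \<open>q > 0\<close> by (auto simp: n_def intro!: mult_left_mono)
  also have "\<dots> = exp (- 2 * \<delta>\<^sup>2 * n * q ^ 3)"
    by (simp add: l_def power2_eq_square power3_eq_cube algebra_simps)
  finally show ?thesis
    by (simp add: q_def n_def)
qed

end

text \<open>The premise \<open>r N \<le> \<rho>\<^sub>0\<close> of the Chernoff and Hoeffding bounds
  means \<open>\<delta> \<ge> 0\<close>. Below that they can fail: two 2-subsets of a 3-element set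
  always meet, so \<open>\<rho>\<^sub>0 = 1/2\<close> gives probability 1, while both bounds are
  less than 1.\<close>

theorem proposition8:
  fixes M :: "'w measure" and D :: "'a set" and S :: "nat \<Rightarrow> 'w \<Rightarrow> 'a set"
    and r :: "nat \<Rightarrow> real" and N C i j :: nat and \<rho>\<^sub>0 \<delta> :: real
  assumes "egalitarian_subsampling M D C S r"
    and "card D = N"
    and "0 < r N" and "r N < 1"
    and "0 < \<rho>\<^sub>0"
    and "i \<in> {1..C}" and "j \<in> {1..C}" and "i \<noteq> j"
    and "\<delta> = \<rho>\<^sub>0 / r N - 1"
  shows
    "prob_space.expectation M (\<lambda>\<omega>. real (card (S i \<omega> \<inter> S j \<omega>))) = real N * (r N)\<^sup>2
     \<and> \<P>(\<omega> in M. real (card (S 1 \<omega> \<inter> S 2 \<omega>)) \<ge> real N * r N * \<rho>\<^sub>0)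
        = \<P>(\<omega> in M. real (card (S 1 \<omega> \<inter> S 2 \<omega>)) \<ge>
            \<rho>\<^sub>0 / r N * prob_space.expectation M (\<lambda>\<omega>'. real (card (S i \<omega>' \<inter> S j \<omega>'))))
     \<and> (r N \<le> \<rho>\<^sub>0 \<longrightarrow>
        \<P>(\<omega> in M. real (card (S 1 \<omega> \<inter> S 2 \<omega>)) \<ge> real N * r N * \<rho>\<^sub>0)
        \<le> (exp \<delta> / (1 + \<delta>) powr (1 + \<delta>)) powr (real N * (r N)\<^sup>2))
     \<and> (r N \<le> \<rho>\<^sub>0 \<longrightarrow>
        \<P>(\<omega> in M. real (card (S 1 \<omega> \<inter> S 2 \<omega>)) \<ge> real N * r N * \<rho>\<^sub>0)
        \<le> exp (- 2 * \<delta>\<^sup>2 * real N * (r N) ^ 3))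
     \<and> \<P>(\<omega> in M. real (card (S 1 \<omega> \<inter> S 2 \<omega>)) \<ge> real N * r N * \<rho>\<^sub>0) \<le> r N / \<rho>\<^sub>0"
proof -
  interpret egalitarian_subsampling M D C S r by fact
  have r: "r (card D) > 0"
    using assms by simp
  \<comment> \<open>Two distinct indices in \<open>{1..C}\<close> force
    \<open>C \<ge> 2\<close>.\<close>
  have 12: "1 \<in> {1..C}" "2 \<in> {1..C}" "(1::nat) \<noteq> 2"
    using assms(6-8) by auto
  note pair = 12 r
  have mean: "expectation (\<lambda>\<omega>. real (card (S i \<omega> \<inter> S j \<omega>))) = real N * (r N)\<^sup>2"
    if "i \<in> {1..C}" "j \<in> {1..C}" "i \<noteq> j" for i j
    using expectation_card_Int[OF that r] assms(2) by simp
  have threshold: "real N * r N * \<rho>\<^sub>0 = (1 + \<delta>) * (real N * (r N)\<^sup>2)"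
    using assms(3,9) by (simp add: power2_eq_square)
  have \<delta>: "0 \<le> \<delta>" if "r N \<le> \<rho>\<^sub>0"
    using that assms(3,9) by simp
  \<comment> \<open>Markov's inequality needs a positive threshold, hence \<open>N > 0\<close>. For
    empty \<open>D\<close> the division by zero in \<open>equal_fraction\<close> would give
    \<open>r (card D) = 0\<close>.\<close>
  have "D \<noteq> {}"
  proof
    obtain \<omega> where "\<omega> \<in> space M"
      using not_empty by blast
    moreover assume "D = {}"
    ultimately show False
      using equal_fraction[OF assms(6)] r by auto
  qed
  then have "N > 0"
    using finite_dataset assms(2) by (auto simp: card_gt_0_iff)
  have "\<P>(\<omega> in M. real (card (S 1 \<omega> \<inter> S 2 \<omega>)) \<ge> real N * r N * \<rho>\<^sub>0)
      \<le> expectation (\<lambda>\<omega>. real (card (S 1 \<omega> \<inter> S 2 \<omega>))) / (real N * r N * \<rho>\<^sub>0)"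
    using \<open>N > 0\<close> assms(3,5) expectation_subsample_pair(2)[OF pair]
    by (intro integral_Markov_inequality_measure[where A = "{}"]) auto
  also have "\<dots> = r N / \<rho>\<^sub>0"
    unfolding mean[OF 12] using \<open>N > 0\<close> assms(3) by (simp add: power2_eq_square)
  finally have markov: "\<P>(\<omega> in M. real (card (S 1 \<omega> \<inter> S 2 \<omega>)) \<ge> real N * r N * \<rho>\<^sub>0) \<le> r N / \<rho>\<^sub>0" .
  have "\<rho>\<^sub>0 / r N * (real N * (r N)\<^sup>2) = real N * r N * \<rho>\<^sub>0"
    using assms(3) by (simp add: power2_eq_square)
  then show ?thesis
    using mean[OF assms(6-8)] markov
      prob_card_Int_Chernoff[OF pair \<delta>] prob_card_Int_Hoeffding[OF pair \<delta>]
    unfolding threshold by (simp add: assms(2) threshold)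
qed

end
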